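(* Let $\varphi$ be a $\mathcal{GML}$ formula over a finite set $\mathsf{PROP}$ of propositional symbols of modal depth at most $L$. The following are equivalent: (1) $\varphi$ is preserved under injective homomorphisms, i.e. whenever $(\mathfrak{M},w)\models\varphi$ and there is an injective homomorphism from $(\mathfrak{M},w)$ to $(\mathfrak{N},v)$, then $(\mathfrak{N},v)\models\varphi$; (2) $\varphi$ is equivalent (over finite pointed models) to an $\exists^+\mathcal{GML}$ formula of modal depth at most $L$.
   Context: All Kripke models are finite: $\mathfrak{M}=(W,R,V)$, $W$ non-empty finite, $R\subseteq W\times W$, $V:\mathsf{PROP}\to 2^W$; a pointed model is $(\mathfrak{M},w)$. A homomorphism from $(\mathfrak{M},w)$ to $(\mathfrak{N},v)$, $\mathfrak{N}=(W',R',V')$, is $f:W\to W'$ with $f(w)=v$ such that $uRz$ implies $f(u)R'f(z)$ and $u\in V(p)$ implies $f(u)\in V'(p)$; it is an injective homomorphism if $f$ is injective. $\mathcal{GML}$: $\varphi::=p\mid\neg\varphi\mid\varphi\wedge\varphi\mid\varphi\vee\varphi\mid\Diamond^{\ge k}\varphi$ ($k\ge1$), $(\mathfrak{M},w)\models\Diamond^{\ge k}\varphi$ iff at least $k$ worlds $u$ with $wRu$ satisfy $\varphi$. Modal depth = maximal nesting of $\Diamond^{\ge k}$. $\exists^+\mathcal{GML}$: the negation-free fragment. Equivalence means satisfaction by the same finite pointed models.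
   Formalization: The constants ⊤ and ⊥ are added to GML and to its negation-free fragment, since without them the claim fails (p∨¬p and p∧¬p are preserved but have no negation-free equivalent); finite models are taken, up to isomorphism, with natural numbers as worlds. *)

theory Defs
  imports Main "HOL-Library.FuncSet"
begin

record ('w, 'p) kripke =
  worlds :: "'w set"
  acc :: "('w \<times> 'w) set"
  val :: "'p \<Rightarrow> 'w set"

text \<open>The set \<open>P\<close> plays the role of \<open>PROP\<close>. Only the values \<open>val M p\<close> with \<open>p \<in> P\<close> belong to a
  model over \<open>P\<close>; no notion below looks at the others.\<close>

definition kripke_model :: "'p set \<Rightarrow> ('w, 'p) kripke \<Rightarrow> bool" where
  "kripke_model P M \<longleftrightarrow>
     finite (worlds M) \<and> worlds M \<noteq> {} \<and> acc M \<subseteq> worlds M \<times> worlds M \<and>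
     (\<forall>p\<in>P. val M p \<subseteq> worlds M)"

definition pointed_model :: "'p set \<Rightarrow> ('w, 'p) kripke \<Rightarrow> 'w \<Rightarrow> bool" where
  "pointed_model P M w \<longleftrightarrow> kripke_model P M \<and> w \<in> worlds M"

definition homomorphism ::
  "'p set \<Rightarrow> ('w, 'p) kripke \<Rightarrow> 'w \<Rightarrow> ('u, 'p) kripke \<Rightarrow> 'u \<Rightarrow> ('w \<Rightarrow> 'u) \<Rightarrow> bool" where
  "homomorphism P M w N v f \<longleftrightarrow>
     f \<in> worlds M \<rightarrow> worlds N \<and> f w = v \<and>
     (\<forall>u z. (u, z) \<in> acc M \<longrightarrow> (f u, f z) \<in> acc N) \<and>
     (\<forall>p\<in>P. \<forall>u. u \<in> val M p \<longrightarrow> f u \<in> val N p)"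

definition injective_homomorphism ::
  "'p set \<Rightarrow> ('w, 'p) kripke \<Rightarrow> 'w \<Rightarrow> ('u, 'p) kripke \<Rightarrow> 'u \<Rightarrow> ('w \<Rightarrow> 'u) \<Rightarrow> bool" where
  "injective_homomorphism P M w N v f \<longleftrightarrow> homomorphism P M w N v f \<and> inj_on f (worlds M)"

text \<open>The constants \<open>\<top>\<close> and \<open>\<bottom>\<close> (empty conjunction and disjunction) are primitive, hence available
  in the negation-free fragment. Without them, no negation-free formula is unsatisfiable and none
  holds at a world with no successors and no true propositional symbol, so that \<open>p \<and> \<not> p\<close> and
  \<open>p \<or> \<not> p\<close> would have no negation-free equivalents.\<close>

datatype 'p gml =
    Top
  | Bot
  | Prop 'p
  | Neg "'p gml"
  | Conj "'p gml" "'p gml"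
  | Disj "'p gml" "'p gml"
  | Dia nat "'p gml"

text \<open>The datatype admits every grade and symbol; GML over \<open>P\<close> requires grades at least \<open>1\<close> and
  symbols from \<open>P\<close>.\<close>

fun gml_formula :: "'p set \<Rightarrow> 'p gml \<Rightarrow> bool" where
  "gml_formula P Top \<longleftrightarrow> True"
| "gml_formula P Bot \<longleftrightarrow> True"
| "gml_formula P (Prop p) \<longleftrightarrow> p \<in> P"
| "gml_formula P (Neg \<phi>) \<longleftrightarrow> gml_formula P \<phi>"
| "gml_formula P (Conj \<phi> \<psi>) \<longleftrightarrow> gml_formula P \<phi> \<and> gml_formula P \<psi>"
| "gml_formula P (Disj \<phi> \<psi>) \<longleftrightarrow> gml_formula P \<phi> \<and> gml_formula P \<psi>"
| "gml_formula P (Dia k \<phi>) \<longleftrightarrow> 1 \<le> k \<and> gml_formula P \<phi>"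

fun negation_free :: "'p gml \<Rightarrow> bool" where
  "negation_free Top \<longleftrightarrow> True"
| "negation_free Bot \<longleftrightarrow> True"
| "negation_free (Prop p) \<longleftrightarrow> True"
| "negation_free (Neg \<phi>) \<longleftrightarrow> False"
| "negation_free (Conj \<phi> \<psi>) \<longleftrightarrow> negation_free \<phi> \<and> negation_free \<psi>"
| "negation_free (Disj \<phi> \<psi>) \<longleftrightarrow> negation_free \<phi> \<and> negation_free \<psi>"
| "negation_free (Dia k \<phi>) \<longleftrightarrow> negation_free \<phi>"

definition ex_pos_gml_formula :: "'p set \<Rightarrow> 'p gml \<Rightarrow> bool" where
  "ex_pos_gml_formula P \<phi> \<longleftrightarrow> gml_formula P \<phi> \<and> negation_free \<phi>"

fun modal_depth :: "'p gml \<Rightarrow> nat" where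
  "modal_depth Top = 0"
| "modal_depth Bot = 0"
| "modal_depth (Prop p) = 0"
| "modal_depth (Neg \<phi>) = modal_depth \<phi>"
| "modal_depth (Conj \<phi> \<psi>) = max (modal_depth \<phi>) (modal_depth \<psi>)"
| "modal_depth (Disj \<phi> \<psi>) = max (modal_depth \<phi>) (modal_depth \<psi>)"
| "modal_depth (Dia k \<phi>) = Suc (modal_depth \<phi>)"

fun sat :: "('w, 'p) kripke \<Rightarrow> 'w \<Rightarrow> 'p gml \<Rightarrow> bool" where
  "sat M w Top \<longleftrightarrow> True"
| "sat M w Bot \<longleftrightarrow> False"
| "sat M w (Prop p) \<longleftrightarrow> w \<in> val M p"
| "sat M w (Neg \<phi>) \<longleftrightarrow> \<not> sat M w \<phi>"
| "sat M w (Conj \<phi> \<psi>) \<longleftrightarrow> sat M w \<phi> \<and> sat M w \<psi>"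
| "sat M w (Disj \<phi> \<psi>) \<longleftrightarrow> sat M w \<phi> \<or> sat M w \<psi>"
| "sat M w (Dia k \<phi>) \<longleftrightarrow> k \<le> card {u \<in> worlds M. (w, u) \<in> acc M \<and> sat M u \<phi>}"

text \<open>A definition cannot quantify over types of worlds, so the next two notions range over the
  finite models with worlds in \<open>nat\<close>. Every finite model is isomorphic to one of these; the lemmas
  at the end of this theory transfer both notions to models over arbitrary types.\<close>

definition preserved_under_injective_homomorphisms :: "'p set \<Rightarrow> 'p gml \<Rightarrow> bool" where
  "preserved_under_injective_homomorphisms P \<phi> \<longleftrightarrow>
     (\<forall>(M :: (nat, 'p) kripke) w (N :: (nat, 'p) kripke) v.
        pointed_model P M w \<and> pointed_model P N v \<and> sat M w \<phi> \<and>
        (\<exists>f. injective_homomorphism P M w N v f) \<longrightarrow> sat N v \<phi>)"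

definition equivalent :: "'p set \<Rightarrow> 'p gml \<Rightarrow> 'p gml \<Rightarrow> bool" where
  "equivalent P \<phi> \<psi> \<longleftrightarrow>
     (\<forall>(M :: (nat, 'p) kripke) w. pointed_model P M w \<longrightarrow> (sat M w \<phi> \<longleftrightarrow> sat M w \<psi>))"

definition rename :: "('w \<Rightarrow> 'u) \<Rightarrow> ('w, 'p) kripke \<Rightarrow> ('u, 'p) kripke" where
  "rename g M = \<lparr>worlds = g ` worlds M, acc = map_prod g g ` acc M, val = (\<lambda>p. g ` val M p)\<rparr>"

lemma pointed_model_rename: "pointed_model P M w \<Longrightarrow> pointed_model P (rename g M) (g w)"
  unfolding pointed_model_def kripke_model_def rename_def by (auto simp: image_mono)

lemma sat_rename:
  assumes "kripke_model P M" "inj_on g (worlds M)" "gml_formula P \<phi>" "w \<in> worlds M"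
  shows "sat (rename g M) (g w) \<phi> \<longleftrightarrow> sat M w \<phi>"
  using assms(3,4)
proof (induction \<phi> arbitrary: w)
  case (Prop p)
  then have "val M p \<subseteq> worlds M" using assms(1) by (auto simp: kripke_model_def)
  with Prop assms(2) show ?case by (auto simp: rename_def inj_on_def)
next
  case (Dia k \<phi>)
  have acc: "acc M \<subseteq> worlds M \<times> worlds M" using assms(1) by (auto simp: kripke_model_def)
  have rel: "(g w, g u) \<in> map_prod g g ` acc M \<longleftrightarrow> (w, u) \<in> acc M" if "u \<in> worlds M" for u
  proof
    assume "(g w, g u) \<in> map_prod g g ` acc M"
    then obtain a b where ab: "(a, b) \<in> acc M" "g w = g a" "g u = g b" by auto
    then have "a \<in> worlds M" "b \<in> worlds M" using acc by auto
    then have "w = a" "u = b" using ab that Dia.prems(2) inj_onD[OF assms(2)] by blast+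
    then show "(w, u) \<in> acc M" using ab(1) by simp
  qed force
  have "{u \<in> worlds (rename g M). (g w, u) \<in> acc (rename g M) \<and> sat (rename g M) u \<phi>}
      = g ` {u \<in> worlds M. (w, u) \<in> acc M \<and> sat M u \<phi>}"
  proof -
    have ren: "worlds (rename g M) = g ` worlds M" "acc (rename g M) = map_prod g g ` acc M"
      by (simp_all add: rename_def)
    have iff: "(g w, g u) \<in> acc (rename g M) \<and> sat (rename g M) (g u) \<phi> \<longleftrightarrow>
        (w, u) \<in> acc M \<and> sat M u \<phi>" if "u \<in> worlds M" for u
      using Dia.IH Dia.prems(1) rel that by (simp add: ren(2))
    have "{x \<in> g ` worlds M. Q x} = g ` {u \<in> worlds M. Q (g u)}" for Q
      by auto
    then show ?thesis unfolding ren(1) using iff by (simp cong: conj_cong)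
  qed
  moreover have "inj_on g {u \<in> worlds M. (w, u) \<in> acc M \<and> sat M u \<phi>}"
    using assms(2) by (auto simp: inj_on_def)
  ultimately show ?case by (simp add: card_image)
qed auto

lemma ex_inj_on_nat: "kripke_model P M \<Longrightarrow> \<exists>g :: 'w \<Rightarrow> nat. inj_on g (worlds M)"
  for M :: "('w, 'p) kripke"
  using finite_imp_inj_to_nat_seg unfolding kripke_model_def by metis

lemma equivalent_any_type:
  fixes M :: "('w, 'p) kripke"
  assumes "equivalent P \<phi> \<psi>" "gml_formula P \<phi>" "gml_formula P \<psi>" "pointed_model P M w"
  shows "sat M w \<phi> \<longleftrightarrow> sat M w \<psi>"
proof -
  have M: "kripke_model P M" "w \<in> worlds M" using assms(4) by (auto simp: pointed_model_def)
  obtain g :: "'w \<Rightarrow> nat" where g: "inj_on g (worlds M)" using ex_inj_on_nat[OF M(1)] by blast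
  have "sat (rename g M) (g w) \<phi> \<longleftrightarrow> sat (rename g M) (g w) \<psi>"
    using assms(1) pointed_model_rename[OF assms(4)] unfolding equivalent_def by blast
  then show ?thesis using sat_rename[OF M(1) g _ M(2)] assms(2,3) by blast
qed

lemma preserved_any_type:
  fixes M :: "('w, 'p) kripke" and N :: "('u, 'p) kripke"
  assumes "preserved_under_injective_homomorphisms P \<phi>" "gml_formula P \<phi>"
    and "pointed_model P M w" "pointed_model P N v"
    and "injective_homomorphism P M w N v f" "sat M w \<phi>"
  shows "sat N v \<phi>"
proof -
  have M: "kripke_model P M" "w \<in> worlds M" using assms(3) by (auto simp: pointed_model_def)
  have N: "kripke_model P N" "v \<in> worlds N" using assms(4) by (auto simp: pointed_model_def)
  obtain g :: "'w \<Rightarrow> nat" where g: "inj_on g (worlds M)" using ex_inj_on_nat[OF M(1)] by blast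
  obtain h :: "'u \<Rightarrow> nat" where h: "inj_on h (worlds N)" using ex_inj_on_nat[OF N(1)] by blast
  define i where "i = inv_into (worlds M) g"
  have i: "i (g u) = u" if "u \<in> worlds M" for u
    using g that by (simp add: i_def)
  have f: "f \<in> worlds M \<rightarrow> worlds N" "f w = v" "inj_on f (worlds M)"
    "\<And>u z. (u, z) \<in> acc M \<Longrightarrow> (f u, f z) \<in> acc N"
    "\<And>p u. p \<in> P \<Longrightarrow> u \<in> val M p \<Longrightarrow> f u \<in> val N p"
    using assms(5) by (auto simp: injective_homomorphism_def homomorphism_def)
  have sub: "acc M \<subseteq> worlds M \<times> worlds M" "\<And>p. p \<in> P \<Longrightarrow> val M p \<subseteq> worlds M"
    using M(1) by (auto simp: kripke_model_def)
  have "homomorphism P (rename g M) (g w) (rename h N) (h v) (\<lambda>x. h (f (i x)))"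
    unfolding homomorphism_def
  proof (intro conjI allI ballI impI)
    show "(\<lambda>x. h (f (i x))) \<in> worlds (rename g M) \<rightarrow> worlds (rename h N)"
      using f(1) i by (auto simp: rename_def)
    show "h (f (i (g w))) = h v" using i M(2) f(2) by simp
  next
    fix x y assume "(x, y) \<in> acc (rename g M)"
    then obtain a b where ab: "x = g a" "y = g b" "(a, b) \<in> acc M" by (auto simp: rename_def)
    then have "i x = a" "i y = b" using sub(1) i by auto
    then show "(h (f (i x)), h (f (i y))) \<in> acc (rename h N)"
      using f(4)[OF ab(3)] by (force simp: rename_def)
  next
    fix p x assume p: "p \<in> P" and "x \<in> val (rename g M) p"
    then obtain a where a: "x = g a" "a \<in> val M p" by (auto simp: rename_def)
    then have "i x = a" using sub(2)[OF p] i by auto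
    then show "h (f (i x)) \<in> val (rename h N) p"
      using f(5)[OF p a(2)] by (auto simp: rename_def)
  qed
  moreover have "inj_on (\<lambda>x. h (f (i x))) (worlds (rename g M))"
  proof (rule inj_onI)
    fix x y assume xy: "x \<in> worlds (rename g M)" "y \<in> worlds (rename g M)"
      and eq: "h (f (i x)) = h (f (i y))"
    obtain a b where ab: "x = g a" "y = g b" "a \<in> worlds M" "b \<in> worlds M"
      using xy by (auto simp: rename_def)
    then have "h (f a) = h (f b)" using eq i by simp
    then have "f a = f b" using h f(1) ab by (meson PiE inj_onD)
    then show "x = y" using f(3) ab by (auto dest: inj_onD)
  qed
  ultimately have "injective_homomorphism P (rename g M) (g w) (rename h N) (h v) (\<lambda>x. h (f (i x)))"
    by (simp add: injective_homomorphism_def)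
  moreover have "sat (rename g M) (g w) \<phi>"
    using sat_rename[OF M(1) g assms(2) M(2)] assms(6) by simp
  ultimately have "sat (rename h N) (h v) \<phi>"
    using assms(1) pointed_model_rename[OF assms(3)] pointed_model_rename[OF assms(4)]
    unfolding preserved_under_injective_homomorphisms_def by blast
  then show ?thesis using sat_rename[OF N(1) h assms(2) N(2)] by simp
qed

end

theory Submission
  imports Defs
begin

text \<open>A formula of modal depth at most \<open>L\<close> only sees the unravelling of a pointed model into a tree
  of height \<open>L\<close>. For a finite tree \<open>t\<close>, the trees into which \<open>t\<close> embeds injectively are defined by a
  negation-free formula: by Hall's marriage theorem, the children of \<open>t\<close> can be matched with distinct
  successors as soon as, for every set \<open>S\<close> of children, at least \<open>card S\<close> successors satisfy the
  disjunction of the formulas of the members of \<open>S\<close>. If \<open>K\<close> bounds the grades of \<open>\<phi>\<close>, then keeping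
  at most \<open>K\<close> children of each kind turns every tree into an embedded subtree from a finite stock
  without affecting \<open>\<phi>\<close>. A preserved \<open>\<phi>\<close> is therefore the disjunction of the formulas of the trees in
  this stock which satisfy \<open>\<phi>\<close>.\<close>

section \<open>Hall's marriage theorem\<close>

text \<open>Halmos-Vaughan induction on the number of indices. If some nonempty proper subfamily is
  tight, meaning that it has exactly as many values as indices, it is matched first and its values
  are withdrawn from the rest. Otherwise every nonempty proper subfamily has a spare value, and one
  index may be matched arbitrarily.\<close>

theorem hall_marriage:
  fixes A :: "'i \<Rightarrow> 'a set"
  assumes "finite I" "\<And>i. i \<in> I \<Longrightarrow> finite (A i)"
    and "\<And>S. S \<subseteq> I \<Longrightarrow> card S \<le> card (\<Union>i\<in>S. A i)"
  shows "\<exists>f. inj_on f I \<and> (\<forall>i\<in>I. f i \<in> A i)"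
  using assms
proof (induction "card I" arbitrary: I A rule: less_induct)
  case less
  note finI = less.prems(1) and finA = less.prems(2) and hall = less.prems(3)
  show ?case
  proof (cases "\<exists>S. S \<subset> I \<and> S \<noteq> {} \<and> card (\<Union>i\<in>S. A i) = card S")
    case True
    then obtain S where S: "S \<subset> I" "S \<noteq> {}" "card (\<Union>i\<in>S. A i) = card S" by blast
    define U where "U = (\<Union>i\<in>S. A i)"
    have finS: "finite S" using S finI finite_subset by blast
    have "\<exists>f. inj_on f S \<and> (\<forall>i\<in>S. f i \<in> A i)"
      using less.hyps[of S A] psubset_card_mono[OF finI S(1)] finS S(1) finA hall by blast
    then obtain f where f: "inj_on f S" "\<forall>i\<in>S. f i \<in> A i" by blast
    \<comment> \<open>A deficit of \<open>T\<close> after the removal of \<open>U\<close> would, as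
      \<open>S\<close> is tight, yield a deficit of the union of \<open>T\<close> and
      \<open>S\<close>.\<close>
    have "card T \<le> card (\<Union>i\<in>T. A i - U)" if T: "T \<subseteq> I - S" for T
    proof -
      have finT: "finite T" using T finI finite_subset by blast
      have "card T + card S = card (T \<union> S)"
        using T finT finS by (subst card_Un_disjoint) auto
      also have "\<dots> \<le> card (\<Union>i\<in>T \<union> S. A i)" using T S by (intro hall) auto
      also have "(\<Union>i\<in>T \<union> S. A i) = (\<Union>i\<in>T. A i - U) \<union> U" by (auto simp: U_def)
      also have "card \<dots> \<le> card (\<Union>i\<in>T. A i - U) + card U" by (rule card_Un_le)
      finally show ?thesis using S(3) by (simp add: U_def)
    qed
    moreover have "card (I - S) < card I"
      using S finI by (intro psubset_card_mono) auto
    ultimately have "\<exists>g. inj_on g (I - S) \<and> (\<forall>i\<in>I - S. g i \<in> A i - U)"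
      using less.hyps[of "I - S" "\<lambda>i. A i - U"] finI finA by auto
    then obtain g where g: "inj_on g (I - S)" "\<forall>i\<in>I - S. g i \<in> A i - U" by blast
    define h where "h i = (if i \<in> S then f i else g i)" for i
    have fU: "f i \<in> U" if "i \<in> S" for i using f that by (auto simp: U_def)
    have "inj_on h I"
    proof (rule inj_onI)
      fix i j assume ij: "i \<in> I" "j \<in> I" "h i = h j"
      have "i \<in> S \<longleftrightarrow> j \<in> S" using ij fU g(2) unfolding h_def by (metis DiffD2 DiffI)
      then show "i = j" using ij f(1) g(1) by (auto simp: h_def inj_on_def split: if_splits)
    qed
    moreover have "\<forall>i\<in>I. h i \<in> A i" using f g by (auto simp: h_def)
    ultimately show ?thesis by blast
  next
    case False
    show ?thesis
    proof (cases "I = {}")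
      case True
      then show ?thesis by simp
    next
      case nonempty: False
      then obtain i where i: "i \<in> I" by blast
      have "card {i} \<le> card (\<Union>j\<in>{i}. A j)" using i by (intro hall) auto
      then obtain a where a: "a \<in> A i" by fastforce
      \<comment> \<open>With no tight subfamily, a nonempty \<open>T\<close> has more values than
        indices, so losing the single value \<open>a\<close> does no harm.\<close>
      have "card T \<le> card (\<Union>j\<in>T. A j - {a})" if T: "T \<subseteq> I - {i}" for T
      proof (cases "T = {}")
        case False
        have "T \<subset> I" using T i by auto
        then have "card T < card (\<Union>j\<in>T. A j)"
          using hall[of T] False \<open>\<not> (\<exists>S. S \<subset> I \<and> S \<noteq> {} \<and> card (\<Union>i\<in>S. A i) = card S)\<close>
          by (metis le_neq_implies_less psubset_imp_subset)
        moreover have "(\<Union>j\<in>T. A j - {a}) = (\<Union>j\<in>T. A j) - {a}" by auto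
        ultimately show ?thesis
          by (metis Suc_pred card_Diff_singleton_if less_Suc_eq_le less_imp_le_nat
              One_nat_def diff_Suc_1 gr_zeroI not_less_zero)
      qed simp
      moreover have "card (I - {i}) < card I" using card_Diff1_less[OF finI i] .
      ultimately have "\<exists>g. inj_on g (I - {i}) \<and> (\<forall>j\<in>I - {i}. g j \<in> A j - {a})"
        using less.hyps[of "I - {i}" "\<lambda>j. A j - {a}"] finI finA by auto
      then obtain g where g: "inj_on g (I - {i})" "\<forall>j\<in>I - {i}. g j \<in> A j - {a}" by blast
      have "inj_on (g(i := a)) I"
        using g by (auto simp: inj_on_def)
      moreover have "\<forall>j\<in>I. (g(i := a)) j \<in> A j" using g a by auto
      ultimately show ?thesis by blast
    qed
  qed
qed

section \<open>Finite trees\<close>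

text \<open>Children form a list rather than a set because graded diamonds count equal subtrees
  separately. For the same reason satisfaction and embeddings refer to indices of children.\<close>

datatype 'p tree = Node (label: "'p set") (children: "'p tree list")

fun tree_sat :: "'p tree \<Rightarrow> 'p gml \<Rightarrow> bool" where
  "tree_sat t Top \<longleftrightarrow> True"
| "tree_sat t Bot \<longleftrightarrow> False"
| "tree_sat t (Prop p) \<longleftrightarrow> p \<in> label t"
| "tree_sat t (Neg \<phi>) \<longleftrightarrow> \<not> tree_sat t \<phi>"
| "tree_sat t (Conj \<phi> \<psi>) \<longleftrightarrow> tree_sat t \<phi> \<and> tree_sat t \<psi>"
| "tree_sat t (Disj \<phi> \<psi>) \<longleftrightarrow> tree_sat t \<phi> \<or> tree_sat t \<psi>"
| "tree_sat t (Dia k \<phi>) \<longleftrightarrow> k \<le> card {i. i < length (children t) \<and> tree_sat (children t ! i) \<phi>}"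

primrec trees :: "'p set \<Rightarrow> nat \<Rightarrow> 'p tree set" where
  "trees P 0 = {Node A [] | A. A \<subseteq> P}"
| "trees P (Suc n) = {Node A ts | A ts. A \<subseteq> P \<and> set ts \<subseteq> trees P n}"

inductive embeds :: "'p tree \<Rightarrow> 'p tree \<Rightarrow> bool" where
  "\<lbrakk>A \<subseteq> B; inj_on f {..<length ts};
    \<And>i. i < length ts \<Longrightarrow> f i < length us \<and> embeds (ts ! i) (us ! f i)\<rbrakk>
   \<Longrightarrow> embeds (Node A ts) (Node B us)"

subsection \<open>Trees as pointed models\<close>

fun subtree_at :: "'p tree \<Rightarrow> nat list \<Rightarrow> 'p tree" where
  "subtree_at t [] = t"
| "subtree_at t (i # q) = subtree_at (children t ! i) q"

fun is_pos :: "'p tree \<Rightarrow> nat list \<Rightarrow> bool" where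
  "is_pos t [] \<longleftrightarrow> True"
| "is_pos t (i # q) \<longleftrightarrow> i < length (children t) \<and> is_pos (children t ! i) q"

text \<open>Worlds are paths of child indices, so equal subtrees at different places give different
  worlds.\<close>

definition tree_model :: "'p tree \<Rightarrow> (nat list, 'p) kripke" where
  "tree_model t = \<lparr>worlds = {q. is_pos t q}, acc = {(q, q @ [i]) | q i. is_pos t (q @ [i])},
     val = (\<lambda>p. {q. is_pos t q \<and> p \<in> label (subtree_at t q)})\<rparr>"

lemma tree_model_simps:
  "worlds (tree_model t) = {q. is_pos t q}"
  "acc (tree_model t) = {(q, q @ [i]) | q i. is_pos t (q @ [i])}"
  "val (tree_model t) p = {q. is_pos t q \<and> p \<in> label (subtree_at t q)}"
  by (simp_all add: tree_model_def)

lemma subtree_at_snoc: "subtree_at t (q @ [i]) = children (subtree_at t q) ! i"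
  by (induction q arbitrary: t) auto

lemma is_pos_snoc: "is_pos t (q @ [i]) \<longleftrightarrow> is_pos t q \<and> i < length (children (subtree_at t q))"
  by (induction q arbitrary: t) auto

lemma finite_positions: "finite {q. is_pos t q}"
proof (induction t)
  case (Node A ts)
  have "{q. is_pos (Node A ts) q} \<subseteq> insert [] (\<Union>i<length ts. (#) i ` {q. is_pos (ts ! i) q})"
  proof
    fix q assume "q \<in> {q. is_pos (Node A ts) q}"
    then show "q \<in> insert [] (\<Union>i<length ts. (#) i ` {q. is_pos (ts ! i) q})"
      by (cases q) auto
  qed
  moreover have "finite (insert [] (\<Union>i<length ts. (#) i ` {q. is_pos (ts ! i) q}))"
    using Node by auto
  ultimately show ?case by (rule finite_subset)
qed

lemma pointed_model_tree_model: "pointed_model P (tree_model t) []"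
  using finite_positions[of t]
  by (auto simp: pointed_model_def kripke_model_def tree_model_def is_pos_snoc intro: exI[of _ "[]"])

lemma sat_tree_model: "is_pos t q \<Longrightarrow> sat (tree_model t) q \<phi> \<longleftrightarrow> tree_sat (subtree_at t q) \<phi>"
proof (induction \<phi> arbitrary: q)
  case (Dia k \<phi>)
  let ?s = "subtree_at t q"
  have "{u \<in> worlds (tree_model t). (q, u) \<in> acc (tree_model t) \<and> sat (tree_model t) u \<phi>}
      = (\<lambda>i. q @ [i]) ` {i. i < length (children ?s) \<and> tree_sat (children ?s ! i) \<phi>}"
    using Dia by (auto simp: tree_model_simps is_pos_snoc subtree_at_snoc)
  then show ?case by (simp add: card_image inj_on_def)
qed (auto simp: tree_model_simps)

text \<open>The maps of the child trees are glued: a path entering child \<open>i\<close> is sent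
  below child \<open>f i\<close>. Injectivity among siblings suffices at each node, since positions
  below different children never coincide.\<close>

lemma injective_homomorphism_of_embeds:
  assumes "embeds t u"
  shows "\<exists>g. injective_homomorphism P (tree_model t) [] (tree_model u) [] g"
proof -
  \<comment> \<open>Edges are described by appending one last index, a form that survives putting an
    index in front. The clause \<open>g [] = []\<close> settles the edges leaving the root.\<close>
  have "\<exists>g. g [] = [] \<and> inj_on g {q. is_pos t q} \<and>
      (\<forall>q. is_pos t q \<longrightarrow> is_pos u (g q) \<and> label (subtree_at t q) \<subseteq> label (subtree_at u (g q))) \<and>
      (\<forall>q i. is_pos t (q @ [i]) \<longrightarrow> (\<exists>j. g (q @ [i]) = g q @ [j]))"
    using assms
  proof induction
    case (1 A B f ts us)
    \<comment> \<open>\<open>R\<close> packages the induction hypothesis, so that one map per child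
      can be chosen at once.\<close>
    define R where "R s u g \<longleftrightarrow> g [] = [] \<and> inj_on g {q. is_pos s q} \<and>
      (\<forall>q. is_pos s q \<longrightarrow> is_pos u (g q) \<and> label (subtree_at s q) \<subseteq> label (subtree_at u (g q))) \<and>
      (\<forall>q i. is_pos s (q @ [i]) \<longrightarrow> (\<exists>j. g (q @ [i]) = g q @ [j]))" for s u :: "'a tree" and g
    have "\<forall>i. \<exists>g. i < length ts \<longrightarrow> R (ts ! i) (us ! f i) g"
      using 1(3) unfolding R_def by blast
    then obtain g where "\<And>i. i < length ts \<Longrightarrow> R (ts ! i) (us ! f i) (g i)" by metis
    then have g: "\<And>i. i < length ts \<Longrightarrow> g i [] = []"
      "\<And>i. i < length ts \<Longrightarrow> inj_on (g i) {q. is_pos (ts ! i) q}"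
      "\<And>i q. \<lbrakk>i < length ts; is_pos (ts ! i) q\<rbrakk> \<Longrightarrow> is_pos (us ! f i) (g i q)"
      "\<And>i q. \<lbrakk>i < length ts; is_pos (ts ! i) q\<rbrakk> \<Longrightarrow>
        label (subtree_at (ts ! i) q) \<subseteq> label (subtree_at (us ! f i) (g i q))"
      "\<And>i q j. \<lbrakk>i < length ts; is_pos (ts ! i) (q @ [j])\<rbrakk> \<Longrightarrow> \<exists>j'. g i (q @ [j]) = g i q @ [j']"
      unfolding R_def by blast+
    define h where "h q = (case q of [] \<Rightarrow> [] | i # r \<Rightarrow> f i # g i r)" for q
    have h: "h [] = []" "h (i # r) = f i # g i r" for i r by (auto simp: h_def)
    have "inj_on h {q. is_pos (Node A ts) q}"
    proof (rule inj_onI)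
      fix q r assume qr: "q \<in> {q. is_pos (Node A ts) q}" "r \<in> {q. is_pos (Node A ts) q}" "h q = h r"
      show "q = r"
      proof (cases q)
        case Nil
        then show ?thesis using qr by (cases r) (auto simp: h)
      next
        case (Cons i q')
        then obtain j r' where r: "r = j # r'" using qr by (cases r) (auto simp: h)
        have ij: "i < length ts" "j < length ts" "f i = f j" using qr Cons r by (auto simp: h)
        then have "i = j" using 1(2) by (auto dest: inj_onD)
        then show ?thesis using qr Cons r g(2)[OF ij(1)] by (auto simp: h dest: inj_onD)
      qed
    qed
    moreover have "is_pos (Node B us) (h q) \<and>
        label (subtree_at (Node A ts) q) \<subseteq> label (subtree_at (Node B us) (h q))"
      if "is_pos (Node A ts) q" for q
      using that 1(1,3) g(3,4) by (cases q) (auto simp: h dest: subsetD)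
    moreover have "\<exists>j. h (q @ [i]) = h q @ [j]" if "is_pos (Node A ts) (q @ [i])" for q i
      using that g(1,5) by (cases q) (auto simp: h)
    ultimately show ?case using h(1) by blast
  qed
  then obtain g where g: "g [] = []" "inj_on g {q. is_pos t q}"
      "\<And>q. is_pos t q \<Longrightarrow> is_pos u (g q)"
      "\<And>q. is_pos t q \<Longrightarrow> label (subtree_at t q) \<subseteq> label (subtree_at u (g q))"
      "\<And>q i. is_pos t (q @ [i]) \<Longrightarrow> \<exists>j. g (q @ [i]) = g q @ [j]"
    by blast
  have "(g q, g (q @ [i])) \<in> acc (tree_model u)" if "is_pos t (q @ [i])" for q i
    using g(5)[OF that] g(3)[OF that] by (auto simp: tree_model_def)
  then have "injective_homomorphism P (tree_model t) [] (tree_model u) [] g"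
    using g(1-3) subsetD[OF g(4)]
    by (auto simp: injective_homomorphism_def homomorphism_def tree_model_simps)
  then show ?thesis by blast
qed

text \<open>Preservation is defined through models over \<open>nat\<close>, whereas the worlds of
  tree models are lists; \<open>preserved_any_type\<close> bridges the difference.\<close>

lemma tree_sat_embeds:
  assumes "preserved_under_injective_homomorphisms P \<phi>" "gml_formula P \<phi>"
    and "embeds t u" "tree_sat t \<phi>"
  shows "tree_sat u \<phi>"
proof -
  obtain g where "injective_homomorphism P (tree_model t) [] (tree_model u) [] g"
    using injective_homomorphism_of_embeds[OF assms(3)] by blast
  then have "sat (tree_model u) [] \<phi>"
    using preserved_any_type[OF assms(1,2) pointed_model_tree_model pointed_model_tree_model]
      sat_tree_model[of t "[]"] assms(4) by simp
  then show ?thesis using sat_tree_model[of u "[]"] by simp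
qed

subsection \<open>Unravelling\<close>

lemma card_nth_distinct:
  assumes "distinct xs"
  shows "card {i. i < length xs \<and> Q (xs ! i)} = card {x \<in> set xs. Q x}"
proof -
  have "{x \<in> set xs. Q x} = (!) xs ` {i. i < length xs \<and> Q (xs ! i)}"
    by (auto simp: in_set_conv_nth)
  moreover have "inj_on ((!) xs) {i. i < length xs \<and> Q (xs ! i)}"
    using assms by (auto simp: inj_on_def nth_eq_iff_index_eq)
  ultimately show ?thesis by (simp add: card_image)
qed

text \<open>The tree of \<open>w\<close> carries the symbols of \<open>P\<close> true at
  \<open>w\<close> and has one child for each successor, namely the successor's own tree of one
  level less. A diamond uses up one unit of modal depth and one level of the tree.\<close>

lemma unravelling_exists:
  assumes "kripke_model P M"
  shows "\<exists>t\<in>trees P n. \<forall>\<psi>. gml_formula P \<psi> \<longrightarrow> modal_depth \<psi> \<le> n \<longrightarrow> (tree_sat t \<psi> \<longleftrightarrow> sat M w \<psi>)"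
proof (induction n arbitrary: w)
  case 0
  let ?t = "Node {p \<in> P. w \<in> val M p} []"
  have "gml_formula P \<psi> \<longrightarrow> modal_depth \<psi> \<le> 0 \<longrightarrow> (tree_sat ?t \<psi> \<longleftrightarrow> sat M w \<psi>)" for \<psi>
    by (induction \<psi>) auto
  moreover have "?t \<in> trees P 0" by auto
  ultimately show ?case by blast
next
  case (Suc n)
  obtain T where T: "\<And>w. T w \<in> trees P n"
    "\<And>w \<psi>. \<lbrakk>gml_formula P \<psi>; modal_depth \<psi> \<le> n\<rbrakk> \<Longrightarrow> tree_sat (T w) \<psi> \<longleftrightarrow> sat M w \<psi>"
    using Suc by metis
  \<comment> \<open>A repetition-free list of the successors gives exactly one child index per
    successor, even when several successors have the same tree.\<close>
  have "finite {u \<in> worlds M. (w, u) \<in> acc M}" using assms by (simp add: kripke_model_def)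
  then obtain xs where xs: "set xs = {u \<in> worlds M. (w, u) \<in> acc M}" "distinct xs"
    using finite_distinct_list by blast
  let ?t = "Node {p \<in> P. w \<in> val M p} (map T xs)"
  have "gml_formula P \<psi> \<longrightarrow> modal_depth \<psi> \<le> Suc n \<longrightarrow> (tree_sat ?t \<psi> \<longleftrightarrow> sat M w \<psi>)" for \<psi>
  proof (induction \<psi>)
    case (Dia k \<psi>)
    show ?case
    proof (intro impI)
      assume "gml_formula P (Dia k \<psi>)" "modal_depth (Dia k \<psi>) \<le> Suc n"
      then have "tree_sat (T u) \<psi> \<longleftrightarrow> sat M u \<psi>" for u using T(2) by simp
      then have "{i. i < length (map T xs) \<and> tree_sat (map T xs ! i) \<psi>}
          = {i. i < length xs \<and> sat M (xs ! i) \<psi>}" by (simp cong: conj_cong)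
      then have "card {i. i < length (map T xs) \<and> tree_sat (map T xs ! i) \<psi>}
          = card {u \<in> worlds M. (w, u) \<in> acc M \<and> sat M u \<psi>}"
        using card_nth_distinct[OF xs(2), of "\<lambda>u. sat M u \<psi>"] xs(1) by simp
      then show "tree_sat ?t (Dia k \<psi>) \<longleftrightarrow> sat M w (Dia k \<psi>)" by simp
    qed
  qed auto
  moreover have "?t \<in> trees P (Suc n)" using T(1) by auto
  ultimately show ?case by blast
qed

section \<open>Negation-free formulas describing embeddings\<close>

text \<open>The empty conjunction is \<open>Top\<close>. Only the meaning of the formula is
  recorded, so no order on \<open>X\<close> has to be fixed.\<close>

lemma ex_conj_of_finite:
  assumes "finite X" "\<And>\<chi>. \<chi> \<in> X \<Longrightarrow> ex_pos_gml_formula P \<chi> \<and> modal_depth \<chi> \<le> n"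
  shows "\<exists>\<psi>. ex_pos_gml_formula P \<psi> \<and> modal_depth \<psi> \<le> n \<and>
    (\<forall>t. tree_sat t \<psi> \<longleftrightarrow> (\<forall>\<chi>\<in>X. tree_sat t \<chi>))"
  using assms
proof (induction rule: finite_induct)
  case empty
  show ?case by (rule exI[of _ Top]) (simp add: ex_pos_gml_formula_def)
next
  case (insert \<chi> X)
  then obtain \<psi> where "ex_pos_gml_formula P \<psi>" "modal_depth \<psi> \<le> n"
    "\<forall>t. tree_sat t \<psi> \<longleftrightarrow> (\<forall>\<chi>\<in>X. tree_sat t \<chi>)" by auto
  then show ?case using insert.prems
    by (intro exI[of _ "Conj \<chi> \<psi>"]) (simp add: ex_pos_gml_formula_def)
qed

lemma ex_disj_of_finite:
  assumes "finite X" "\<And>\<chi>. \<chi> \<in> X \<Longrightarrow> ex_pos_gml_formula P \<chi> \<and> modal_depth \<chi> \<le> n"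
  shows "\<exists>\<psi>. ex_pos_gml_formula P \<psi> \<and> modal_depth \<psi> \<le> n \<and>
    (\<forall>t. tree_sat t \<psi> \<longleftrightarrow> (\<exists>\<chi>\<in>X. tree_sat t \<chi>))"
  using assms
proof (induction rule: finite_induct)
  case empty
  show ?case by (rule exI[of _ Bot]) (simp add: ex_pos_gml_formula_def)
next
  case (insert \<chi> X)
  then obtain \<psi> where "ex_pos_gml_formula P \<psi>" "modal_depth \<psi> \<le> n"
    "\<forall>t. tree_sat t \<psi> \<longleftrightarrow> (\<exists>\<chi>\<in>X. tree_sat t \<chi>)" by auto
  then show ?case using insert.prems
    by (intro exI[of _ "Disj \<chi> \<psi>"]) (simp add: ex_pos_gml_formula_def)
qed

text \<open>Hall's theorem, applied to the sets of children of \<open>u\<close> that can receive a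
  given child, trades the existence of an injection for lower bounds on cardinalities. Such bounds
  are what graded diamonds express.\<close>

lemma embeds_iff_hall:
  "embeds (Node A ts) u \<longleftrightarrow> A \<subseteq> label u \<and>
    (\<forall>S\<subseteq>{..<length ts}. card S \<le>
      card {j. j < length (children u) \<and> (\<exists>i\<in>S. embeds (ts ! i) (children u ! j))})"
  (is "_ \<longleftrightarrow> _ \<and> ?hall")
proof
  assume "embeds (Node A ts) u"
  then obtain f where f: "A \<subseteq> label u" "inj_on f {..<length ts}"
    "\<And>i. i < length ts \<Longrightarrow> f i < length (children u) \<and> embeds (ts ! i) (children u ! f i)"
    by (cases rule: embeds.cases) auto
  have "card S \<le> card {j. j < length (children u) \<and> (\<exists>i\<in>S. embeds (ts ! i) (children u ! j))}"
    if S: "S \<subseteq> {..<length ts}" for S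
  proof (rule card_inj_on_le)
    show "inj_on f S" using f(2) S inj_on_subset by blast
  qed (use f(3) S in auto)
  then show "A \<subseteq> label u \<and> ?hall" using f(1) by blast
next
  assume *: "A \<subseteq> label u \<and> ?hall"
  define B where "B i = {j. j < length (children u) \<and> embeds (ts ! i) (children u ! j)}" for i
  have "(\<Union>i\<in>S. B i) = {j. j < length (children u) \<and> (\<exists>i\<in>S. embeds (ts ! i) (children u ! j))}" for S
    by (auto simp: B_def)
  then have "\<exists>f. inj_on f {..<length ts} \<and> (\<forall>i\<in>{..<length ts}. f i \<in> B i)"
    using * by (intro hall_marriage) (auto simp: B_def)
  then obtain f where "inj_on f {..<length ts}" "\<forall>i\<in>{..<length ts}. f i \<in> B i" by blast
  then have "embeds (Node A ts) (Node (label u) (children u))"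
    using * by (intro embeds.intros[of _ _ f]) (auto simp: B_def)
  then show "embeds (Node A ts) u" by simp
qed

text \<open>Each counting condition of \<open>embeds_iff_hall\<close> becomes a diamond of grade
  \<open>card S\<close> over the disjunction of the formulas of the children in \<open>S\<close>.
  This disjunction has depth at most \<open>n\<close>, so the diamond has depth at most
  \<open>Suc n\<close>.\<close>

lemma ex_pos_formula_of_embeds:
  assumes "finite P" "t \<in> trees P n"
  shows "\<exists>\<chi>. ex_pos_gml_formula P \<chi> \<and> modal_depth \<chi> \<le> n \<and> (\<forall>u. tree_sat u \<chi> \<longleftrightarrow> embeds t u)"
  using assms(2)
proof (induction n arbitrary: t)
  case 0
  then obtain A where A: "t = Node A []" "A \<subseteq> P" by auto
  then have "\<exists>\<psi>. ex_pos_gml_formula P \<psi> \<and> modal_depth \<psi> \<le> 0 \<and>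
      (\<forall>u. tree_sat u \<psi> \<longleftrightarrow> (\<forall>\<chi>\<in>Prop ` A. tree_sat u \<chi>))"
    using assms(1) finite_subset by (intro ex_conj_of_finite) (auto simp: ex_pos_gml_formula_def)
  then show ?case using A(1) by (auto simp: embeds_iff_hall subset_iff)
next
  case (Suc n)
  then obtain A ts where t: "t = Node A ts" "A \<subseteq> P" "set ts \<subseteq> trees P n" by auto
  define good where "good \<psi> m \<longleftrightarrow> ex_pos_gml_formula P \<psi> \<and> modal_depth \<psi> \<le> m" for \<psi> m
  have "\<forall>i. \<exists>\<chi>. i < length ts \<longrightarrow> good \<chi> n \<and> (\<forall>u. tree_sat u \<chi> \<longleftrightarrow> embeds (ts ! i) u)"
    using Suc.IH t(3) unfolding good_def by (meson nth_mem subsetD)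
  then obtain C where C: "\<And>i. i < length ts \<Longrightarrow> good (C i) n"
    "\<And>i u. i < length ts \<Longrightarrow> tree_sat u (C i) \<longleftrightarrow> embeds (ts ! i) u" by metis
  have "\<exists>\<psi>. good \<psi> n \<and> (\<forall>u. tree_sat u \<psi> \<longleftrightarrow> (\<exists>i\<in>S. embeds (ts ! i) u))"
    if S: "S \<subseteq> {..<length ts}" for S
  proof -
    have "\<exists>\<psi>. ex_pos_gml_formula P \<psi> \<and> modal_depth \<psi> \<le> n \<and>
        (\<forall>u. tree_sat u \<psi> \<longleftrightarrow> (\<exists>\<chi>\<in>C ` S. tree_sat u \<chi>))"
      using S C(1) finite_subset[OF S] by (intro ex_disj_of_finite) (auto simp: good_def)
    moreover have "(\<exists>\<chi>\<in>C ` S. tree_sat u \<chi>) \<longleftrightarrow> (\<exists>i\<in>S. embeds (ts ! i) u)" for u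
      using S C(2) by auto
    ultimately show ?thesis by (auto simp: good_def)
  qed
  then obtain D where D: "\<And>S. S \<subseteq> {..<length ts} \<Longrightarrow> good (D S) n"
    "\<And>S u. S \<subseteq> {..<length ts} \<Longrightarrow> tree_sat u (D S) \<longleftrightarrow> (\<exists>i\<in>S. embeds (ts ! i) u)"
    by metis
  \<comment> \<open>The empty \<open>S\<close> is left out, as its diamond would have the illegal
    grade 0.\<close>
  define X where "X = Prop ` A \<union> (\<lambda>S. Dia (card S) (D S)) ` (Pow {..<length ts} - {{}})"
  have pos: "Suc 0 \<le> card S" if "S \<subseteq> {..<length ts}" "x \<in> S" for S x
    using that finite_subset[OF that(1)] by (auto simp: Suc_le_eq card_gt_0_iff)
  have "\<exists>\<psi>. ex_pos_gml_formula P \<psi> \<and> modal_depth \<psi> \<le> Suc n \<and>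
      (\<forall>u. tree_sat u \<psi> \<longleftrightarrow> (\<forall>\<chi>\<in>X. tree_sat u \<chi>))"
    using assms(1) t(2) finite_subset D(1) pos
    by (intro ex_conj_of_finite) (auto simp: X_def good_def ex_pos_gml_formula_def)
  moreover have "(\<forall>\<chi>\<in>X. tree_sat u \<chi>) \<longleftrightarrow> embeds t u" for u
  proof -
    have "(\<forall>\<chi>\<in>X. tree_sat u \<chi>) \<longleftrightarrow> A \<subseteq> label u \<and>
        (\<forall>S\<subseteq>{..<length ts}. S \<noteq> {} \<longrightarrow> tree_sat u (Dia (card S) (D S)))"
      unfolding X_def ball_Un ball_simps by (auto simp del: tree_sat.simps(7))
    \<comment> \<open>For empty \<open>S\<close> the counting condition bounds a cardinality below
      by 0, so restoring it changes nothing.\<close>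
    also have "\<dots> \<longleftrightarrow> embeds t u"
      unfolding t(1) embeds_iff_hall using D(2) by (intro conj_cong refl all_cong) auto
    finally show ?thesis .
  qed
  ultimately show ?case by auto
qed

section \<open>Pruning\<close>

fun max_grade :: "'p gml \<Rightarrow> nat" where
  "max_grade Top = 0"
| "max_grade Bot = 0"
| "max_grade (Prop p) = 0"
| "max_grade (Neg \<phi>) = max_grade \<phi>"
| "max_grade (Conj \<phi> \<psi>) = max (max_grade \<phi>) (max_grade \<psi>)"
| "max_grade (Disj \<phi> \<psi>) = max (max_grade \<phi>) (max_grade \<psi>)"
| "max_grade (Dia k \<phi>) = max k (max_grade \<phi>)"

text \<open>Dropping children changes only how many of them satisfy a formula. A bound on grades
  makes large counts indistinguishable, while the modal depth may stay arbitrary.\<close>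

definition graded_equiv :: "nat \<Rightarrow> 'p tree \<Rightarrow> 'p tree \<Rightarrow> bool" where
  "graded_equiv K s t \<longleftrightarrow> (\<forall>\<psi>. max_grade \<psi> \<le> K \<longrightarrow> (tree_sat s \<psi> \<longleftrightarrow> tree_sat t \<psi>))"

text \<open>The labels agree and Boolean connectives pass through an induction, which leaves only
  the diamonds.\<close>

lemma graded_equiv_NodeI:
  assumes "\<And>k \<psi>. \<lbrakk>k \<le> K; max_grade \<psi> \<le> K\<rbrakk> \<Longrightarrow>
    tree_sat (Node A ss) (Dia k \<psi>) \<longleftrightarrow> tree_sat (Node A ts) (Dia k \<psi>)"
  shows "graded_equiv K (Node A ss) (Node A ts)"
proof -
  have "max_grade \<psi> \<le> K \<longrightarrow> (tree_sat (Node A ss) \<psi> \<longleftrightarrow> tree_sat (Node A ts) \<psi>)" for \<psi>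
    by (induction \<psi>) (use assms in auto)
  then show ?thesis by (simp add: graded_equiv_def)
qed

text \<open>Read \<open>c\<close> as a colouring of \<open>I\<close>. Each colour class is kept
  whole or cut down to \<open>K\<close> members, and a count of whole colours cannot notice this at
  thresholds up to \<open>K\<close>.\<close>

lemma ex_truncated_fibres:
  assumes "finite I" "finite F" "c ` I \<subseteq> F"
  shows "\<exists>J\<subseteq>I. card J \<le> K * card F \<and>
    (\<forall>Q k. k \<le> K \<longrightarrow> (k \<le> card {i \<in> J. Q (c i)} \<longleftrightarrow> k \<le> card {i \<in> I. Q (c i)}))"
proof -
  have "\<exists>B. B \<subseteq> {i \<in> I. c i = x} \<and> card B \<le> K \<and> (card B = K \<or> B = {i \<in> I. c i = x})" for x
  proof (cases "K \<le> card {i \<in> I. c i = x}")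
    case True
    then obtain B where "B \<subseteq> {i \<in> I. c i = x}" "card B = K"
      by (rule obtain_subset_with_card_n)
    then show ?thesis by blast
  next
    case False
    then show ?thesis by (intro exI[of _ "{i \<in> I. c i = x}"]) simp
  qed
  then obtain B where B: "\<And>x. B x \<subseteq> {i \<in> I. c i = x}" "\<And>x. card (B x) \<le> K"
    "\<And>x. card (B x) = K \<or> B x = {i \<in> I. c i = x}" by metis
  define J where "J = (\<Union>x\<in>F. B x)"
  have J: "J \<subseteq> I" using B(1) by (auto simp: J_def)
  have "card J \<le> (\<Sum>x\<in>F. card (B x))" unfolding J_def using assms(2) by (rule card_UN_le)
  also have "\<dots> \<le> (\<Sum>x\<in>F. K)" using B(2) by (rule sum_mono)
  finally have "card J \<le> K * card F" by (simp add: mult.commute)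
  moreover have "k \<le> card {i \<in> J. Q (c i)} \<longleftrightarrow> k \<le> card {i \<in> I. Q (c i)}" if k: "k \<le> K" for Q k
  \<comment> \<open>Either one colour satisfying \<open>Q\<close> already contributes
    \<open>K\<close> elements, so both counts reach \<open>k\<close>, or every colour satisfying
    \<open>Q\<close> is kept whole and the two sets coincide.\<close>
  proof (cases "\<exists>x\<in>F. Q x \<and> card (B x) = K")
    case True
    then obtain x where x: "x \<in> F" "Q x" "card (B x) = K" by blast
    have "B x \<subseteq> {i \<in> J. Q (c i)}" using B(1)[of x] x by (auto simp: J_def)
    then have "K \<le> card {i \<in> J. Q (c i)}"
      using x(3) finite_subset[OF J assms(1)] card_mono[of "{i \<in> J. Q (c i)}" "B x"] by simp
    moreover have "card {i \<in> J. Q (c i)} \<le> card {i \<in> I. Q (c i)}"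
      using J assms(1) by (intro card_mono) auto
    ultimately show ?thesis using k by linarith
  next
    case False
    then have "B x = {i \<in> I. c i = x}" if "x \<in> F" "Q x" for x using B(3) that by blast
    then have "{i \<in> J. Q (c i)} = {i \<in> I. Q (c i)}"
      using assms(3) J by (auto simp: J_def intro!: bexI[of _ "c _"])
    then show ?thesis by simp
  qed
  ultimately show ?thesis using J by blast
qed

text \<open>Each child is first replaced by its representative in the stock of the previous level,
  then at most \<open>K\<close> children with the same representative are kept. This bounds the
  number of children, hence the stock.\<close>

lemma finite_pruned_trees:
  assumes "finite P"
  shows "\<exists>F. finite F \<and> F \<subseteq> trees P n \<and> (\<forall>t\<in>trees P n. \<exists>s\<in>F. embeds s t \<and> graded_equiv K s t)"
proof (induction n)
  case 0
  have "trees P 0 = (\<lambda>A. Node A []) ` Pow P" by auto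
  then have "finite (trees P 0)" using assms by simp
  moreover have "embeds t t \<and> graded_equiv K t t" if "t \<in> trees P 0" for t
    using that by (auto simp: embeds_iff_hall graded_equiv_def)
  ultimately show ?case by blast
next
  case (Suc n)
  then obtain F where F: "finite F" "F \<subseteq> trees P n"
    "\<And>t. t \<in> trees P n \<Longrightarrow> \<exists>s\<in>F. embeds s t \<and> graded_equiv K s t" by blast
  then obtain c where c: "\<And>t. t \<in> trees P n \<Longrightarrow> c t \<in> F"
    "\<And>t. t \<in> trees P n \<Longrightarrow> embeds (c t) t" "\<And>t. t \<in> trees P n \<Longrightarrow> graded_equiv K (c t) t"
    by metis
  define G where "G = (\<lambda>(A, ts). Node A ts) ` (Pow P \<times> {ts. set ts \<subseteq> F \<and> length ts \<le> K * card F})"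
  have "finite G" using assms F(1) by (auto simp: G_def finite_lists_length_le)
  moreover have "G \<subseteq> trees P (Suc n)" using F(2) by (auto simp: G_def)
  moreover have "\<exists>s\<in>G. embeds s t \<and> graded_equiv K s t" if t_in: "t \<in> trees P (Suc n)" for t
  proof -
    obtain A ts where t: "t = Node A ts" "A \<subseteq> P" "set ts \<subseteq> trees P n" using t_in by auto
    have ts: "ts ! i \<in> trees P n" if "i < length ts" for i using that t(3) nth_mem by blast
    \<comment> \<open>Child indices are coloured by their representatives. Whether a representative
      satisfies a formula depends only on the colour.\<close>
    obtain J where J: "J \<subseteq> {..<length ts}" "card J \<le> K * card F"
      "\<And>Q k. k \<le> K \<Longrightarrow> k \<le> card {i \<in> J. Q (c (ts ! i))} \<longleftrightarrow>
        k \<le> card {i \<in> {..<length ts}. Q (c (ts ! i))}"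
      using ex_truncated_fibres[of "{..<length ts}" F "\<lambda>i. c (ts ! i)" K] F(1) c(1) ts
      by (auto simp: image_subset_iff)
    have "finite J" using J(1) finite_subset by blast
    then obtain js where js: "set js = J" "distinct js" using finite_distinct_list by blast
    let ?s = "Node A (map (\<lambda>i. c (ts ! i)) js)"
    have len: "length js = card J" using js distinct_card by fastforce
    have js_less: "js ! i < length ts" if "i < length js" for i
      using that js(1) J(1) nth_mem by fastforce
    have "?s \<in> G" using t(2) J(1,2) c(1) ts len js(1) by (auto simp: G_def image_iff)
    moreover have "embeds ?s t"
      unfolding t(1)
    \<comment> \<open>Child \<open>i\<close> of the pruned tree represents child
      \<open>js ! i\<close> of the original one and embeds into it.\<close>
    proof (rule embeds.intros[of _ _ "(!) js"])
      show "inj_on ((!) js) {..<length (map (\<lambda>i. c (ts ! i)) js)}"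
        using js(2) by (auto simp: inj_on_def nth_eq_iff_index_eq)
    qed (use js_less c(2) ts in auto)
    moreover have "graded_equiv K ?s t"
      unfolding t(1)
    proof (rule graded_equiv_NodeI)
      fix k \<psi> assume k: "k \<le> K" and \<psi>: "max_grade (\<psi> :: 'a gml) \<le> K"
      have "card {i. i < length js \<and> tree_sat (c (ts ! (js ! i))) \<psi>}
          = card {i \<in> J. tree_sat (c (ts ! i)) \<psi>}"
        using card_nth_distinct[OF js(2), of "\<lambda>i. tree_sat (c (ts ! i)) \<psi>"] js(1) by simp
      moreover have "{i. i < length js \<and> tree_sat (map (\<lambda>i. c (ts ! i)) js ! i) \<psi>}
          = {i. i < length js \<and> tree_sat (c (ts ! (js ! i))) \<psi>}" by auto
      \<comment> \<open>As \<open>\<psi>\<close> has grades at most \<open>K\<close>, passing to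
        representatives does not affect which children satisfy it.\<close>
      moreover have "{i \<in> {..<length ts}. tree_sat (c (ts ! i)) \<psi>}
          = {i. i < length ts \<and> tree_sat (ts ! i) \<psi>}"
        using c(3) ts \<psi> by (auto simp: graded_equiv_def)
      ultimately show "tree_sat ?s (Dia k \<psi>) \<longleftrightarrow> tree_sat (Node A ts) (Dia k \<psi>)"
        using J(3)[OF k, of "\<lambda>t. tree_sat t \<psi>"] by simp
    qed
    ultimately show ?thesis by blast
  qed
  ultimately show ?case by blast
qed

section \<open>The preservation theorem\<close>

text \<open>At a diamond, injectivity keeps the witnessing successors distinct, so their number
  cannot decrease. The absence of negation keeps every step monotone.\<close>

lemma sat_injective_homomorphism:
  assumes "pointed_model P M w" "pointed_model P N v" "injective_homomorphism P M w N v f"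
    and "ex_pos_gml_formula P \<psi>" "sat M w \<psi>"
  shows "sat N v \<psi>"
proof -
  have f: "f \<in> worlds M \<rightarrow> worlds N" "f w = v" "inj_on f (worlds M)"
    "\<And>u z. (u, z) \<in> acc M \<Longrightarrow> (f u, f z) \<in> acc N"
    "\<And>p u. p \<in> P \<Longrightarrow> u \<in> val M p \<Longrightarrow> f u \<in> val N p"
    using assms(3) by (auto simp: injective_homomorphism_def homomorphism_def)
  \<comment> \<open>Since \<open>card\<close> is 0 on infinite sets, comparing the two counts
    requires the target set to be finite.\<close>
  have fin: "finite (worlds N)" using assms(2) by (simp add: pointed_model_def kripke_model_def)
  have "sat N (f u) \<psi>" if "gml_formula P \<psi>" "negation_free \<psi>" "sat M u \<psi>" for u
    using that
  proof (induction \<psi> arbitrary: u)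
    case (Dia k \<psi>)
    have "card {z \<in> worlds M. (u, z) \<in> acc M \<and> sat M z \<psi>}
        \<le> card {z \<in> worlds N. (f u, z) \<in> acc N \<and> sat N z \<psi>}"
    proof (rule card_inj_on_le)
      show "inj_on f {z \<in> worlds M. (u, z) \<in> acc M \<and> sat M z \<psi>}"
        using f(3) by (rule inj_on_subset) auto
    qed (use Dia f(1,4) fin in auto)
    then show ?case using Dia.prems by simp
  qed (use f(5) in auto)
  then show ?thesis using assms(4,5) f(2) by (auto simp: ex_pos_gml_formula_def)
qed

theorem theorem4p8:
  fixes P :: "'p set" and \<phi> :: "'p gml" and L :: nat
  assumes "finite P"
    and "gml_formula P \<phi>"
    and "modal_depth \<phi> \<le> L"
  shows "preserved_under_injective_homomorphisms P \<phi> \<longleftrightarrow>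
    (\<exists>\<psi>. ex_pos_gml_formula P \<psi> \<and> modal_depth \<psi> \<le> L \<and> equivalent P \<phi> \<psi>)"
proof
  assume pres: "preserved_under_injective_homomorphisms P \<phi>"
  \<comment> \<open>Taking the largest grade of \<open>\<phi>\<close> as the bound makes pruning
    preserve the truth value of \<open>\<phi>\<close>.\<close>
  obtain F where F: "finite F" "F \<subseteq> trees P L"
    "\<And>t. t \<in> trees P L \<Longrightarrow> \<exists>s\<in>F. embeds s t \<and> graded_equiv (max_grade \<phi>) s t"
    using finite_pruned_trees[OF assms(1)] by metis
  have "\<forall>s. \<exists>\<chi>. s \<in> F \<longrightarrow> ex_pos_gml_formula P \<chi> \<and> modal_depth \<chi> \<le> L \<and>
      (\<forall>u. tree_sat u \<chi> \<longleftrightarrow> embeds s u)"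
    using ex_pos_formula_of_embeds[OF assms(1)] F(2) by blast
  then obtain C where C: "\<And>s. s \<in> F \<Longrightarrow> ex_pos_gml_formula P (C s) \<and> modal_depth (C s) \<le> L"
    "\<And>s u. s \<in> F \<Longrightarrow> tree_sat u (C s) \<longleftrightarrow> embeds s u" by metis
  have "\<exists>\<psi>. ex_pos_gml_formula P \<psi> \<and> modal_depth \<psi> \<le> L \<and>
      (\<forall>u. tree_sat u \<psi> \<longleftrightarrow> (\<exists>\<chi>\<in>C ` {s \<in> F. tree_sat s \<phi>}. tree_sat u \<chi>))"
    using F(1) C(1) by (intro ex_disj_of_finite) auto
  then obtain \<psi> where \<psi>: "ex_pos_gml_formula P \<psi>" "modal_depth \<psi> \<le> L"
    "\<And>u. tree_sat u \<psi> \<longleftrightarrow> (\<exists>s\<in>F. tree_sat s \<phi> \<and> embeds s u)"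
    using C(2) by (auto simp: Bex_def)
  \<comment> \<open>From left to right, the pruned form of \<open>t\<close> is in \<open>F\<close>,
    satisfies \<open>\<phi>\<close> and embeds into \<open>t\<close>. From right to left,
    preservation carries \<open>\<phi>\<close> along the embedding.\<close>
  have tree: "tree_sat t \<phi> \<longleftrightarrow> tree_sat t \<psi>" if "t \<in> trees P L" for t
  proof
    assume "tree_sat t \<phi>"
    then show "tree_sat t \<psi>" using F(3)[OF that] \<psi>(3) by (auto simp: graded_equiv_def)
  next
    assume "tree_sat t \<psi>"
    then show "tree_sat t \<phi>" using \<psi>(3) tree_sat_embeds[OF pres assms(2)] by blast
  qed
  have "equivalent P \<phi> \<psi>"
    unfolding equivalent_def
  proof (intro allI impI)
    fix M :: "(nat, 'p) kripke" and w assume "pointed_model P M w"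
    \<comment> \<open>Both formulas use symbols of \<open>P\<close> and have depth at most
      \<open>L\<close>, so one unravelling of height \<open>L\<close> decides both of them at
      \<open>w\<close>.\<close>
    then obtain t where t: "t \<in> trees P L"
      "\<And>\<psi>. \<lbrakk>gml_formula P \<psi>; modal_depth \<psi> \<le> L\<rbrakk> \<Longrightarrow> tree_sat t \<psi> \<longleftrightarrow> sat M w \<psi>"
      using unravelling_exists[of P M L w] by (auto simp: pointed_model_def)
    then show "sat M w \<phi> \<longleftrightarrow> sat M w \<psi>"
      using tree[OF t(1)] assms(2,3) \<psi>(1,2) by (simp add: ex_pos_gml_formula_def)
  qed
  then show "\<exists>\<psi>. ex_pos_gml_formula P \<psi> \<and> modal_depth \<psi> \<le> L \<and> equivalent P \<phi> \<psi>"
    using \<psi> by blast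
next
  assume "\<exists>\<psi>. ex_pos_gml_formula P \<psi> \<and> modal_depth \<psi> \<le> L \<and> equivalent P \<phi> \<psi>"
  then obtain \<psi> where \<psi>: "ex_pos_gml_formula P \<psi>" "equivalent P \<phi> \<psi>" by blast
  then show "preserved_under_injective_homomorphisms P \<phi>"
    unfolding preserved_under_injective_homomorphisms_def equivalent_def
    using sat_injective_homomorphism by metis
qed

end
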